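(* Let $x,\tilde x\in\mathbb{E}$ and $s,\tilde s\in\mathbb{E}^*$ satisfy the following conditions, where $\delta_P:=x-\mu\tilde x$ and $\delta_D:=s-\mu\tilde s$: - $0<\langle\tilde s,x\rangle=\langle s,\tilde x\rangle=:\vartheta$; - $0<\langle s,x\rangle=:\vartheta\mu$; - $0<\langle\tilde s,\tilde x\rangle=:\vartheta\tilde\mu$; - $\langle\delta_D,\delta_P\rangle>0$. Let $H$ be a symmetric positive-definite matrix (representing a self-adjoint positive-definite map $\mathbb{E}^*\to\mathbb{E}$). Define $$H_1:=\left(I-\frac{xs^\top}{\langle s,x\rangle}\right)H\left(I-\frac{sx^\top}{\langle s,x\rangle}\right)+\frac{xx^\top}{\langle s,x\rangle},$$ $$H_2:=\left(I-\frac{\delta_P\delta_D^\top}{\langle\delta_D,\delta_P\rangle}\right)H_1\left(I-\frac{\delta_D\delta_P^\top}{\langle\delta_D,\delta_P\rangle}\right)+\frac{\delta_P\delta_P^\top}{\langle\delta_D,\delta_P\rangle}.$$ Then $H_2$ is symmetric, positive-definite, maps $s$ to $x$, and maps $\tilde s$ to $\tilde x$.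
   Context: $\mathbb{E}$ is a finite-dimensional real vector space with dual $\mathbb{E}^*$ and pairing $\langle\cdot,\cdot\rangle$; both are identified with $\mathbb{R}^n$ via a fixed inner product, so that linear maps are $n\times n$ matrices, vectors are column vectors, $\langle u,h\rangle=u^\top h$, and $ab^\top$ is the usual rank-one matrix. *)

theory Defs
  imports "HOL-Analysis.Analysis"
begin

text \<open>
  Both the space and its dual are identified with \<open>real ^ 'n\<close> through a fixed inner product,
  so the pairing of a dual vector \<open>u\<close> with \<open>h\<close> is \<open>u \<bullet> h\<close>.
\<close>

text \<open>
  The matrix \<open>a b\<^sup>T\<close>. The type constraint is needed because the library's row and column
  vectors leave their second dimension free.
\<close>

definition outer :: "real ^ 'n \<Rightarrow> real ^ 'n \<Rightarrow> real ^ 'n ^ 'n"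
  where "outer a b = (columnvector a :: real ^ 1 ^ 'n) ** rowvector b"

lemma outer_nth: "outer a b $ i $ j = a $ i * b $ j"
  by (simp add: outer_def matrix_matrix_mult_def columnvector_def rowvector_def)

definition sym_matrix :: "real ^ 'n ^ 'n \<Rightarrow> bool"
  where "sym_matrix A \<longleftrightarrow> transpose A = A"

text \<open>Symmetry is not part of this predicate; it is always stated separately.\<close>

definition pos_def :: "real ^ 'n ^ 'n \<Rightarrow> bool"
  where "pos_def A \<longleftrightarrow> (\<forall>v. v \<noteq> 0 \<longrightarrow> v \<bullet> (A *v v) > 0)"

end

theory Submission
  imports Defs
begin

text \<open>
  Each of \<open>H\<^sub>1\<close> and \<open>H\<^sub>2\<close> is a BFGS update, which preserves symmetry and positive definiteness and
  satisfies its secant equation, so \<open>H\<^sub>1 s = x\<close> and \<open>H\<^sub>2 \<delta>\<^sub>D = \<delta>\<^sub>P\<close>. The hypotheses make \<open>\<delta>\<^sub>D\<close> orthogonal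
  to \<open>x\<close> and \<open>\<delta>\<^sub>P\<close> orthogonal to \<open>s\<close>, hence the second update does not disturb \<open>H\<^sub>1 s = x\<close>. The equation
  \<open>H\<^sub>2 s' = x'\<close> is then the difference of the two secant equations divided by \<open>\<mu>\<close>, which is nonzero.
\<close>

lemma transpose_outer: "transpose (outer a b) = outer b a"
  by (simp add: vec_eq_iff transpose_def outer_nth mult.commute)

lemma outer_mult_vec: "outer a b *v v = (b \<bullet> v) *\<^sub>R a"
  by (simp add: vec_eq_iff outer_nth matrix_vector_mult_def inner_vec_def sum_distrib_left
      sum_distrib_right algebra_simps)

lemma transpose_add: "transpose (A + B) = transpose A + transpose (B :: real ^ 'n ^ 'm)"
  by (simp add: vec_eq_iff transpose_def)

lemma transpose_diff: "transpose (A - B) = transpose A - transpose (B :: real ^ 'n ^ 'm)"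
  by (simp add: vec_eq_iff transpose_def)

text \<open>The inverse-Hessian form of BFGS, with step \<open>p\<close> and gradient difference
  \<open>y\<close>.\<close>

definition bfgs_update :: "real ^ 'n ^ 'n \<Rightarrow> real ^ 'n \<Rightarrow> real ^ 'n \<Rightarrow> real ^ 'n ^ 'n"
  where "bfgs_update A y p =
    (mat 1 - (1 / (y \<bullet> p)) *\<^sub>R outer p y) ** A ** (mat 1 - (1 / (y \<bullet> p)) *\<^sub>R outer y p)
      + (1 / (y \<bullet> p)) *\<^sub>R outer p p"

lemma sym_matrix_bfgs_update:
  assumes "sym_matrix A"
  shows "sym_matrix (bfgs_update A y p)"
  using assms
  by (simp add: sym_matrix_def bfgs_update_def transpose_add transpose_diff transpose_scalar
      transpose_outer matrix_transpose_mul transpose_mat matrix_mul_assoc)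

lemma projection_mult_vec: "(mat 1 - c *\<^sub>R outer a b) *v v = v - (c * (b \<bullet> v)) *\<^sub>R a"
  by (simp add: matrix_vector_mult_diff_rdistrib scaleR_matrix_vector_assoc [symmetric]
      outer_mult_vec)

text \<open>Acting on a vector eliminates the matrix products; \<open>w\<close> is shared because
  the left factor uses it twice.\<close>

lemma bfgs_update_mult_vec:
  "bfgs_update A y p *v v =
    (let w = A *v (v - (1 / (y \<bullet> p) * (p \<bullet> v)) *\<^sub>R y)
     in w - (1 / (y \<bullet> p) * (y \<bullet> w)) *\<^sub>R p + (1 / (y \<bullet> p) * (p \<bullet> v)) *\<^sub>R p)"
  by (simp add: bfgs_update_def Let_def matrix_vector_mult_add_rdistrib projection_mult_vec
      matrix_vector_mul_assoc [symmetric] scaleR_matrix_vector_assoc [symmetric] outer_mult_vec)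

text \<open>The outer factors are transposes of each other, so the quadratic form at
  \<open>v\<close> is that of \<open>A\<close> at the image of \<open>v\<close> under the right
  factor, plus a positive multiple of \<open>(p \<bullet> v)\<^sup>2\<close>. If the square
  vanishes, that image is \<open>v\<close> itself.\<close>

lemma pos_def_bfgs_update:
  fixes A :: "real ^ 'n ^ 'n"
  assumes "pos_def A" and "y \<bullet> p > 0"
  shows "pos_def (bfgs_update A y p)"
  unfolding pos_def_def
proof (intro allI impI)
  fix v :: "real ^ 'n"
  assume "v \<noteq> 0"
  define c where "c = 1 / (y \<bullet> p)"
  define w where "w = v - (c * (p \<bullet> v)) *\<^sub>R y"
  have "c > 0"
    using assms by (simp add: c_def)
  have "bfgs_update A y p *v v = A *v w - (c * (y \<bullet> (A *v w))) *\<^sub>R p + (c * (p \<bullet> v)) *\<^sub>R p"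
    by (simp add: bfgs_update_mult_vec Let_def c_def w_def)
  moreover have "w \<bullet> (A *v w) = v \<bullet> (A *v w) - c * (p \<bullet> v) * (y \<bullet> (A *v w))"
    by (simp add: w_def inner_diff_left)
  ultimately have quad: "v \<bullet> (bfgs_update A y p *v v) = w \<bullet> (A *v w) + c * (p \<bullet> v)\<^sup>2"
    by (simp add: inner_diff_right inner_add_right inner_commute [of v p] power2_eq_square)
  show "v \<bullet> (bfgs_update A y p *v v) > 0"
  proof (cases "p \<bullet> v = 0")
    case True
    then have "w = v"
      by (simp add: w_def)
    then show ?thesis
      using quad True assms(1) \<open>v \<noteq> 0\<close> by (simp add: pos_def_def)
  next
    case False
    have "w \<bullet> (A *v w) \<ge> 0"
      using assms(1) by (cases "w = 0") (auto simp: pos_def_def less_imp_le)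
    moreover have "c * (p \<bullet> v)\<^sup>2 > 0"
      using False \<open>c > 0\<close> by simp
    ultimately show ?thesis
      using quad by linarith
  qed
qed

text \<open>The right factor annihilates \<open>y\<close>, so only the rank-one term
  contributes.\<close>

lemma bfgs_update_secant:
  assumes "y \<bullet> p \<noteq> 0"
  shows "bfgs_update A y p *v y = p"
  using assms by (simp add: bfgs_update_mult_vec Let_def inner_commute [of p y])

text \<open>The first condition makes the right factor fix \<open>v\<close> and removes the rank-one
  term; the second makes the left factor fix \<open>A *v v\<close>.\<close>

lemma bfgs_update_orthogonal:
  assumes "p \<bullet> v = 0" and "y \<bullet> (A *v v) = 0"
  shows "bfgs_update A y p *v v = A *v v"
  using assms by (simp add: bfgs_update_mult_vec Let_def)

theorem theorem4p2:
  fixes x x' s s' \<delta>\<^sub>P \<delta>\<^sub>D :: "real ^ 'n"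
    and \<theta> \<mu> \<mu>' :: real
    and H H\<^sub>1 H\<^sub>2 :: "real ^ 'n ^ 'n"
  assumes "\<delta>\<^sub>P = x - \<mu> *\<^sub>R x'"
    and "\<delta>\<^sub>D = s - \<mu> *\<^sub>R s'"
    and "0 < s' \<bullet> x" and "s' \<bullet> x = s \<bullet> x'" and "s \<bullet> x' = \<theta>"
    and "0 < s \<bullet> x" and "s \<bullet> x = \<theta> * \<mu>"
    and "0 < s' \<bullet> x'" and "s' \<bullet> x' = \<theta> * \<mu>'"
    and "\<delta>\<^sub>D \<bullet> \<delta>\<^sub>P > 0"
    and "sym_matrix H" and "pos_def H"
    and "H\<^sub>1 = (mat 1 - (1 / (s \<bullet> x)) *\<^sub>R outer x s) ** H
                ** (mat 1 - (1 / (s \<bullet> x)) *\<^sub>R outer s x)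
              + (1 / (s \<bullet> x)) *\<^sub>R outer x x"
    and "H\<^sub>2 = (mat 1 - (1 / (\<delta>\<^sub>D \<bullet> \<delta>\<^sub>P)) *\<^sub>R outer \<delta>\<^sub>P \<delta>\<^sub>D) ** H\<^sub>1
                ** (mat 1 - (1 / (\<delta>\<^sub>D \<bullet> \<delta>\<^sub>P)) *\<^sub>R outer \<delta>\<^sub>D \<delta>\<^sub>P)
              + (1 / (\<delta>\<^sub>D \<bullet> \<delta>\<^sub>P)) *\<^sub>R outer \<delta>\<^sub>P \<delta>\<^sub>P"
  shows "sym_matrix H\<^sub>2 \<and> pos_def H\<^sub>2 \<and> H\<^sub>2 *v s = x \<and> H\<^sub>2 *v s' = x'"
proof -
  have H1: "H\<^sub>1 = bfgs_update H s x" and H2: "H\<^sub>2 = bfgs_update H\<^sub>1 \<delta>\<^sub>D \<delta>\<^sub>P"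
    by (simp_all only: assms(13,14) bfgs_update_def)
  have H1s: "H\<^sub>1 *v s = x"
    unfolding H1 using assms(6) by (simp add: bfgs_update_secant)
  \<comment> \<open>Both \<open>s \<bullet> x'\<close> and \<open>s' \<bullet> x\<close> equal
    \<open>\<theta>\<close>, so in this product and the next \<open>\<theta> * \<mu>\<close>
    cancels.\<close>
  have "\<delta>\<^sub>P \<bullet> s = 0"
    using assms(1,4,5,7) by (simp add: inner_diff_right inner_commute [of _ s])
  moreover have "\<delta>\<^sub>D \<bullet> x = 0"
    using assms(2,4,5,7) by (simp add: inner_diff_left)
  \<comment> \<open>As \<open>H\<^sub>1\<close> sends \<open>s\<close> to \<open>x\<close>,
    orthogonality of \<open>\<delta>\<^sub>D\<close> to \<open>x\<close> is the second condition
    needed.\<close>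
  ultimately have H2s: "H\<^sub>2 *v s = x"
    unfolding H2 using H1s by (simp add: bfgs_update_orthogonal)
  have "H\<^sub>2 *v \<delta>\<^sub>D = \<delta>\<^sub>P"
    unfolding H2 using assms(10) by (simp add: bfgs_update_secant)
  then have "\<mu> *\<^sub>R (H\<^sub>2 *v s') = \<mu> *\<^sub>R x'"
    using H2s assms(1,2)
    by (simp add: matrix_vector_mult_diff_distrib matrix_vector_mult_scaleR)
  moreover have "\<mu> \<noteq> 0"
    using assms(6,7) by auto
  ultimately have "H\<^sub>2 *v s' = x'"
    by simp
  moreover have "sym_matrix H\<^sub>2"
    unfolding H1 H2 by (intro sym_matrix_bfgs_update assms(11))
  moreover have "pos_def H\<^sub>2"
    unfolding H1 H2 by (intro pos_def_bfgs_update assms(6,10,12))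
  ultimately show ?thesis
    using H2s by blast
qed

end
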